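(* Let $G$ be a connected graph with $p$ vertices and $q$ edges such that $e(v_i)>1$ for every vertex $v_i$ of $G$. If the complement $\overline{G}$ is also connected, then $$W_\epsilon(G)+W_\epsilon(\overline{G})\leq\frac12\Big((p-1)\big(\varepsilon^*(G)+\varepsilon^*(\overline{G})\big)-\big(\zeta(G)-\zeta(\overline{G})\big)\Big).$$
   Context: Graphs are finite, simple, undirected. For a connected graph $H$ with vertices $v_1,\ldots,v_p$, $d(v_i,v_j)$ is the distance, $e(v_i)=\max_j d(v_i,v_j)$ the eccentricity, and $\deg(v_i)$ the degree. The eccentricity matrix $\epsilon(H)$ has $(i,j)$ entry $d(v_i,v_j)$ if $d(v_i,v_j)=\min\{e(v_i),e(v_j)\}$ and $0$ otherwise. $W_\epsilon(H)=\frac12\sum_{i,j}(\epsilon(H))_{ij}$; $\varepsilon^*(H)=\sum_i e(v_i)$; $\zeta(H)=\sum_i\deg(v_i)e(v_i)$. $\overline{G}$ is the complement of $G$. *)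

theory Defs
  imports "Graph_Theory.Graph_Theory"
begin

text \<open>
  A finite simple undirected graph is a \<^locale>\<open>pair_graph\<close>: a finite vertex set together with
  a symmetric, irreflexive set of arcs, every undirected edge being represented by the two arcs
  between its end points.
\<close>

definition edges :: "'a pair_pre_digraph \<Rightarrow> 'a set set" where
  "edges G = (\<lambda>(u, v). {u, v}) ` parcs G"

definition complement :: "'a pair_pre_digraph \<Rightarrow> 'a pair_pre_digraph" where
  "complement G =
    \<lparr> pverts = pverts G,
      parcs = {(u, v). u \<in> pverts G \<and> v \<in> pverts G \<and> u \<noteq> v \<and> (u, v) \<notin> parcs G} \<rparr>"

text \<open>Since the arc set is symmetric, the out-degree counts each incident edge exactly once.\<close>

definition degree :: "'a pair_pre_digraph \<Rightarrow> 'a \<Rightarrow> nat" where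
  "degree G v = out_degree (with_proj G) v"

text \<open>Only meaningful for vertices joined by a walk; for these it is the usual shortest-path
  distance, see \<open>gdist_eq_mu\<close> below.\<close>

definition gdist :: "'a pair_pre_digraph \<Rightarrow> 'a \<Rightarrow> 'a \<Rightarrow> nat" where
  "gdist G u v = (LEAST n. \<exists>w. pre_digraph.awalk (with_proj G) u w v \<and> length w = n)"

definition eccentricity :: "'a pair_pre_digraph \<Rightarrow> 'a \<Rightarrow> nat" where
  "eccentricity G v = Max (gdist G v ` pverts G)"

text \<open>The matrix is indexed by the vertices themselves rather than by an enumeration of them;
  the entry sum does not depend on the enumeration.\<close>

definition ecc_matrix :: "'a pair_pre_digraph \<Rightarrow> 'a \<Rightarrow> 'a \<Rightarrow> real" where
  "ecc_matrix G u v =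
    (if gdist G u v = min (eccentricity G u) (eccentricity G v) then real (gdist G u v) else 0)"

definition ecc_wiener :: "'a pair_pre_digraph \<Rightarrow> real" where
  "ecc_wiener G = 1 / 2 * (\<Sum>u\<in>pverts G. \<Sum>v\<in>pverts G. ecc_matrix G u v)"

definition total_ecc :: "'a pair_pre_digraph \<Rightarrow> real" where
  "total_ecc G = (\<Sum>v\<in>pverts G. real (eccentricity G v))"

definition ecc_connectivity :: "'a pair_pre_digraph \<Rightarrow> real" where
  "ecc_connectivity G = (\<Sum>v\<in>pverts G. real (degree G v) * real (eccentricity G v))"

lemma pair_graph_complement:
  assumes "pair_graph G"
  shows "pair_graph (complement G)"
proof -
  interpret pair_graph G by fact
  have sym: "(v, u) \<in> parcs G" if "(u, v) \<in> parcs G" for u v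
    using that arcs_symmetric by blast
  have fin: "finite (parcs (complement G))"
    by (rule finite_subset[of _ "pverts G \<times> pverts G"]) (auto simp: complement_def)
  show ?thesis
    using sym fin finite_verts
    by unfold_locales (auto simp: complement_def symmetric_def arcs_ends_conv sym_def)
qed

lemma gdist_eq_mu:
  assumes "pair_graph G" "u \<rightarrow>\<^sup>*\<^bsub>with_proj G\<^esub> v"
  shows "ereal (real (gdist G u v)) = wf_digraph.\<mu> (with_proj G) (\<lambda>_. 1) u v"
proof -
  interpret pair_graph G by fact
  have cost: "awalk_cost (\<lambda>_. 1) w = real (length w)" for w :: "('a \<times> 'a) list"
    by (induct w) auto
  have "\<exists>w. awalk u w v" using assms(2) reachable_awalk by blast
  then have ex: "\<exists>n w. awalk u w v \<and> length w = n" by blast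
  obtain w where w: "awalk u w v" "length w = gdist G u v"
    using LeastI_ex[OF ex] unfolding gdist_def by blast
  have le: "gdist G u v \<le> length w'" if "awalk u w' v" for w'
    unfolding gdist_def by (rule Least_le) (use that in blast)
  show ?thesis
  proof (rule antisym)
    show "ereal (real (gdist G u v)) \<le> \<mu> (\<lambda>_. 1) u v"
      unfolding \<mu>_def by (rule INF_greatest) (use le cost in auto)
    show "\<mu> (\<lambda>_. 1) u v \<le> ereal (real (gdist G u v))"
      using min_cost_le_walk_cost[OF w(1), of "\<lambda>_. 1"] w(2) cost by simp
  qed
qed

end

theory Submission
  imports Defs
begin

text \<open>
  Since all eccentricities of \<open>G\<close> exceed 1, adjacent vertices contribute nothing to the
  eccentricity matrix of \<open>G\<close>, so the row of \<open>v\<close> has at most \<open>p - 1 - deg v\<close> nonzero entries, each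
  bounded by \<open>e(v)\<close>.  In the complement the cruder count \<open>p - 1\<close> suffices, because the right-hand
  side contains the complement's eccentric connectivity index with a positive sign.
\<close>

lemma (in pair_graph) gdist_self:
  assumes "u \<in> pverts G"
  shows "gdist G u u = 0"
  unfolding gdist_def by (rule Least_eq_0) (use assms awalk_Nil_iff in auto)

lemma (in pair_graph) gdist_arc_le_1:
  assumes "(u, v) \<in> parcs G"
  shows "gdist G u v \<le> 1"
proof -
  have "awalk u [(u, v)] v"
    using assms arc_implies_awalk[of "(u, v)"] by simp
  then show ?thesis
    unfolding gdist_def by (intro Least_le) auto
qed

text \<open>A nonzero entry is the minimum of the two eccentricities, hence at most the first
  one.\<close>

lemma ecc_matrix_le_eccentricity: "ecc_matrix G u v \<le> real (eccentricity G u)"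
  by (simp add: ecc_matrix_def)

lemma (in pair_graph) ecc_matrix_self:
  assumes "u \<in> pverts G"
  shows "ecc_matrix G u u = 0"
  using gdist_self[OF assms] by (simp add: ecc_matrix_def)

text \<open>The minimum of the eccentricities is at least 2, while adjacent vertices are at distance
  at most 1, so the defining equality of a nonzero entry fails.\<close>

lemma (in pair_graph) ecc_matrix_arc:
  assumes "(u, v) \<in> parcs G" "eccentricity G u > 1" "eccentricity G v > 1"
  shows "ecc_matrix G u v = 0"
  using gdist_arc_le_1[OF assms(1)] assms(2,3) by (auto simp: ecc_matrix_def)

lemma degree_eq_card: "degree G u = card {v. (u, v) \<in> parcs G}"
proof -
  have "out_arcs (with_proj G) u = Pair u ` {v. (u, v) \<in> parcs G}"
    by (auto simp: out_arcs_def)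
  then show ?thesis
    by (simp add: degree_def out_degree_def card_image inj_on_def)
qed

text \<open>Common row bound for both graphs: \<open>N\<close> collects off-diagonal columns known
  to vanish. It is empty for the complement and the neighbourhood of \<open>u\<close> for the graph
  itself. The 1 accounts for the diagonal entry.\<close>

lemma (in pair_graph) sum_ecc_matrix_le:
  assumes "u \<in> pverts G" "N \<subseteq> pverts G" "u \<notin> N" "\<And>v. v \<in> N \<Longrightarrow> ecc_matrix G u v = 0"
  shows "(\<Sum>v\<in>pverts G. ecc_matrix G u v)
    \<le> (real (card (pverts G)) - 1 - real (card N)) * real (eccentricity G u)"
proof -
  let ?N = "insert u N"
  have fin: "finite (pverts G)" and sub: "?N \<subseteq> pverts G"
    using finite_verts assms(1,2) by auto
  have finN: "finite N"
    using finite_subset[OF assms(2) fin] .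
  have "(\<Sum>v\<in>pverts G. ecc_matrix G u v) = (\<Sum>v\<in>pverts G - ?N. ecc_matrix G u v)"
    by (rule sum.mono_neutral_right) (use fin assms ecc_matrix_self in auto)
  also have "\<dots> \<le> real (card (pverts G - ?N)) * real (eccentricity G u)"
    by (rule sum_bounded_above) (rule ecc_matrix_le_eccentricity)
  \<comment> \<open>\<open>card_mono\<close> rules out truncation, so the natural-number difference
    passes to the reals.\<close>
  also have "real (card (pverts G - ?N)) = real (card (pverts G)) - real (card ?N)"
    using fin sub finN by (simp only: card_Diff_subset finite_insert of_nat_diff card_mono)
  also have "real (card ?N) = 1 + real (card N)"
    using finN assms(3) by simp
  finally show ?thesis
    by (simp add: algebra_simps)
qed

lemma (in pair_graph) ecc_wiener_le:
  "ecc_wiener G \<le> 1 / 2 * ((real (card (pverts G)) - 1) * total_ecc G)"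
  \<comment> \<open>Fixing the factor in \<open>sum_distrib_left\<close> keeps the outer 1/2 in
    front, so that the sums can be compared row by row.\<close>
  unfolding ecc_wiener_def total_ecc_def sum_distrib_left[of "real (card (pverts G)) - 1"]
  by (intro mult_left_mono sum_mono order_trans[OF sum_ecc_matrix_le[of _ "{}"]]) auto

lemma (in pair_graph) ecc_wiener_le_diff:
  assumes "\<forall>v\<in>pverts G. eccentricity G v > 1"
  shows "ecc_wiener G
    \<le> 1 / 2 * ((real (card (pverts G)) - 1) * total_ecc G - ecc_connectivity G)"
proof -
  have "(\<Sum>v\<in>pverts G. ecc_matrix G u v)
      \<le> (real (card (pverts G)) - 1) * real (eccentricity G u)
        - real (degree G u) * real (eccentricity G u)" if u: "u \<in> pverts G" for u
  proof -
    \<comment> \<open>These make the neighbourhood of \<open>u\<close> admissible as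
      \<open>N\<close>; its cardinality is the degree.\<close>
    have V: "v \<in> pverts G" "v \<noteq> u" if "(u, v) \<in> parcs G" for v
      using that in_arcsD2 no_loops[of "(u, v)"] by auto
    have "(\<Sum>v\<in>pverts G. ecc_matrix G u v)
        \<le> (real (card (pverts G)) - 1 - real (degree G u)) * real (eccentricity G u)"
      unfolding degree_eq_card
      by (rule sum_ecc_matrix_le) (use u V assms ecc_matrix_arc in auto)
    then show ?thesis
      by (simp add: algebra_simps)
  qed
  then show ?thesis
    unfolding ecc_wiener_def total_ecc_def ecc_connectivity_def sum_subtractf[symmetric]
      sum_distrib_left[of "real (card (pverts G)) - 1"]
    by (intro mult_left_mono sum_mono) auto
qed

theorem theorem4p6:
  fixes G :: "'a pair_pre_digraph" and p q :: nat
  assumes "pair_graph G"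
    and "Digraph_Component.connected (with_proj G)"
    and "card (pverts G) = p"
    and "card (edges G) = q"
    and "\<forall>v\<in>pverts G. eccentricity G v > 1"
    and "Digraph_Component.connected (with_proj (complement G))"
  shows "ecc_wiener G + ecc_wiener (complement G)
    \<le> 1 / 2 * ((real p - 1) * (total_ecc G + total_ecc (complement G))
               - (ecc_connectivity G - ecc_connectivity (complement G)))"
proof -
  have "ecc_wiener G \<le> 1 / 2 * ((real p - 1) * total_ecc G - ecc_connectivity G)"
    using pair_graph.ecc_wiener_le_diff[OF assms(1,5)] assms(3) by simp
  moreover have "ecc_wiener (complement G) \<le> 1 / 2 * ((real p - 1) * total_ecc (complement G))"
    using pair_graph.ecc_wiener_le[OF pair_graph_complement[OF assms(1)]] assms(3)
    by (simp add: complement_def)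
  \<comment> \<open>Half of this quantity is exactly the gap between the sum of the two bounds and
    the claimed right-hand side.\<close>
  moreover have "0 \<le> ecc_connectivity (complement G)"
    by (simp add: ecc_connectivity_def sum_nonneg)
  ultimately show ?thesis
    unfolding distrib_left right_diff_distrib by linarith
qed

end
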